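(* Consider any Discoverer algorithm solving the source detection game with obliviously dynamic source behavior and known static graph, watching a single node per round, with success probability $p>0$. Then there is an infinite family of graphs on which the price of detection under that algorithm is at least $\min(1/3,\,p/2)\,n^2$, where $n$ is the number of nodes.
   Context: A temporal graph $\mathcal{G}=(V,E,\lambda)$ with lifetime $T_{\max}$ consists of a finite simple undirected graph $(V,E)$, called the underlying static graph, together with a labeling $\lambda\colon E\to\{1,\dots,T_{\max}\}$. The edge $e$ is present only at time $\lambda(e)$. Write $n=|V|$. Infections follow the SIR model with duration $\delta\ge1$. A node may be seed-infected at some time. A susceptible node $u$ becomes infected at time $t$ iff some neighbor $v$ is infectious at time $t$ and $\lambda(uv)=t$; exactly one such neighbor counts as its infector. The node $u$ is then infectious at times $t+1,\dots,t+\delta$ and resistant afterwards. SD game: an Adversary fixes the temporal graph, $T_{\max}$, $\delta$, and a source node $s$, which is fixed for the whole game. The Discoverer is told $V$, $E$ (known static graph), $T_{\max}$ and $\delta$, but not $\lambda$. In each round the Discoverer watches one node. All nodes start susceptible, the source is seed-infected at a time chosen by the Adversary for that round, and an infection chain unfolds. The Discoverer learns whether, when, and by which neighbor the watched node was infected (or that it was the seed). Obliviously dynamic source behavior means the seed time (and hence the chain) may change between rounds, but the Adversary never learns which nodes are watched. The Discoverer eventually names a node and wins iff it is $s$. The price of detection is the total number of nodes infected, summed over all rounds, until the Discoverer stops. *)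

theory Defs
  imports "HOL-Probability.Probability"
begin

record temporal_graph =
  verts :: "nat set"
  edges :: "nat set set"
  label :: "nat set \<Rightarrow> nat"
  lifetime :: nat

definition wf_temporal_graph :: "temporal_graph \<Rightarrow> bool" where
  "wf_temporal_graph G \<longleftrightarrow>
     finite (verts G) \<and>
     (\<forall>e\<in>edges G. e \<subseteq> verts G \<and> card e = 2) \<and>
     (\<forall>e\<in>edges G. label G e \<in> {1..lifetime G})"

definition infectious :: "nat \<Rightarrow> (nat \<rightharpoonup> nat) \<Rightarrow> nat \<Rightarrow> nat \<Rightarrow> bool" where
  "infectious \<delta> I v t \<longleftrightarrow> (\<exists>t'. I v = Some t' \<and> t' + 1 \<le> t \<and> t \<le> t' + \<delta>)"

text \<open>The neighbors from which \<open>u\<close> can catch the infection at time \<open>t\<close>, where \<open>I\<close> gives the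
  infection times so far.\<close>
definition infectors :: "temporal_graph \<Rightarrow> nat \<Rightarrow> (nat \<rightharpoonup> nat) \<Rightarrow> nat \<Rightarrow> nat \<Rightarrow> nat set" where
  "infectors G \<delta> I u t = {v. {u, v} \<in> edges G \<and> label G {u, v} = t \<and> infectious \<delta> I v t}"

text \<open>\<open>infected_by G \<delta> s t\<^sub>0 t\<close> maps each node infected at some time \<open>\<le> t\<close> to the time of its
  infection, in the chain where \<open>s\<close> is seed-infected at time \<open>t\<^sub>0\<close>.\<close>
primrec infected_by :: "temporal_graph \<Rightarrow> nat \<Rightarrow> nat \<Rightarrow> nat \<Rightarrow> nat \<Rightarrow> (nat \<rightharpoonup> nat)" where
  "infected_by G \<delta> s t\<^sub>0 0 = (\<lambda>u. if u = s \<and> t\<^sub>0 = 0 then Some 0 else None)"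
| "infected_by G \<delta> s t\<^sub>0 (Suc t) = (\<lambda>u.
     let I = infected_by G \<delta> s t\<^sub>0 t in
     case I u of
       Some t' \<Rightarrow> Some t'
     | None \<Rightarrow>
         if (u = s \<and> t\<^sub>0 = Suc t) \<or> infectors G \<delta> I u (Suc t) \<noteq> {} then Some (Suc t) else None)"

text \<open>A strategy of an oblivious Adversary: \<open>seed_time A k\<close> is the seed time of round \<open>k\<close>, and
  \<open>infector A k u\<close> is the neighbor that counts as infector of \<open>u\<close> in round \<open>k\<close> (a genuine choice
  only if several neighbors transmit simultaneously).  Both are fixed in advance, i.e. independent
  of the nodes that are watched.\<close>
record adversary =
  graph :: temporal_graph
  duration :: nat
  source :: nat
  seed_time :: "nat \<Rightarrow> nat"
  infector :: "nat \<Rightarrow> nat \<Rightarrow> nat"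

definition infection_times :: "adversary \<Rightarrow> nat \<Rightarrow> (nat \<rightharpoonup> nat)" where
  "infection_times A k =
     infected_by (graph A) (duration A) (source A) (seed_time A k) (lifetime (graph A))"

definition wf_adversary :: "adversary \<Rightarrow> bool" where
  "wf_adversary A \<longleftrightarrow>
     wf_temporal_graph (graph A) \<and>
     1 \<le> duration A \<and>
     source A \<in> verts (graph A) \<and>
     (\<forall>k. seed_time A k \<le> lifetime (graph A)) \<and>
     (\<forall>k u t. infection_times A k u = Some t \<and> u \<noteq> source A \<longrightarrow>
        infector A k u \<in> infectors (graph A) (duration A) (infection_times A k) u t)"

datatype observation = Not_Infected | Seed_Infected nat | Infected_By nat nat

definition observe :: "adversary \<Rightarrow> nat \<Rightarrow> nat \<Rightarrow> observation" where
  "observe A k u =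
     (case infection_times A k u of
        None \<Rightarrow> Not_Infected
      | Some t \<Rightarrow> if u = source A then Seed_Infected t else Infected_By t (infector A k u))"

datatype action = Watch nat | Name nat

text \<open>A deterministic Discoverer maps \<open>V\<close>, \<open>E\<close>, the lifetime, the infection duration and the
  observations made so far to the next action.\<close>
type_synonym strategy =
  "nat set \<Rightarrow> nat set set \<Rightarrow> nat \<Rightarrow> nat \<Rightarrow> observation list \<Rightarrow> action"

definition act :: "strategy \<Rightarrow> adversary \<Rightarrow> observation list \<Rightarrow> action" where
  "act S A h = S (verts (graph A)) (edges (graph A)) (lifetime (graph A)) (duration A) h"

text \<open>The observations made before round \<open>k\<close>; constant once the Discoverer has named a node.\<close>
primrec history :: "strategy \<Rightarrow> adversary \<Rightarrow> nat \<Rightarrow> observation list" where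
  "history S A 0 = []"
| "history S A (Suc k) =
     (case act S A (history S A k) of
        Watch v \<Rightarrow> history S A k @ [observe A k v]
      | Name v \<Rightarrow> history S A k)"

definition names :: "strategy \<Rightarrow> adversary \<Rightarrow> nat \<Rightarrow> bool" where
  "names S A v \<longleftrightarrow> (\<exists>k. act S A (history S A k) = Name v)"

definition wins :: "strategy \<Rightarrow> adversary \<Rightarrow> bool" where
  "wins S A \<longleftrightarrow> names S A (source A)"

definition plays_round :: "strategy \<Rightarrow> adversary \<Rightarrow> nat \<Rightarrow> bool" where
  "plays_round S A k \<longleftrightarrow> (\<exists>v. act S A (history S A k) = Watch v)"

definition price :: "strategy \<Rightarrow> adversary \<Rightarrow> ennreal" where
  "price S A = (\<Sum>k. if plays_round S A k then of_nat (card (dom (infection_times A k))) else 0)"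

text \<open>A randomized Discoverer is a random variable on a probability space \<open>M\<close> whose values are
  deterministic Discoverers.\<close>
definition discoverer :: "'w measure \<Rightarrow> ('w \<Rightarrow> strategy) \<Rightarrow> bool" where
  "discoverer M D \<longleftrightarrow>
     prob_space M \<and>
     (\<forall>A h. wf_adversary A \<longrightarrow>
        (\<lambda>\<omega>. act (D \<omega>) A h) \<in> measurable M (count_space UNIV) \<and>
        (\<forall>\<omega>\<in>space M. \<forall>v. act (D \<omega>) A h = Watch v \<longrightarrow> v \<in> verts (graph A)))"

definition solves_source_detection :: "'w measure \<Rightarrow> ('w \<Rightarrow> strategy) \<Rightarrow> real \<Rightarrow> bool" where
  "solves_source_detection M D p \<longleftrightarrow>
     (\<forall>A. wf_adversary A \<longrightarrow>
        (AE \<omega> in M. \<exists>v. names (D \<omega>) A v) \<and>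
        p \<le> measure M {\<omega> \<in> space M. wins (D \<omega>) A})"

end

theory Submission
  imports Defs
begin

text \<open>
  The vertices are \<open>L\<^sup>3\<close> hubs, one of which is the source, and only \<open>3 * L\<^sup>2\<close> auxiliary nodes.  In
  each round the seed time selects a hub \<open>v\<close>; the source infects \<open>v\<close> and no other node, \<open>v\<close> enters a
  path of relays, and the path ends in a centre that infects all remaining hubs at once.  Hence a
  round costs at least \<open>L\<^sup>3\<close>, and the observation does not depend on the source unless the watched
  node is the source or \<open>v\<close>.

  Choose the source and the hubs \<open>v\<close> of the first \<open>K\<close> rounds independently and uniformly among the
  \<open>N = L\<^sup>3\<close> hubs.  A Discoverer that stops within \<open>K\<close> rounds never watches the current \<open>v\<close> with
  probability at least \<open>(1 - 1/N)\<^sup>K\<close>, and independently of this, it neither watches nor names the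
  source with probability at least \<open>1 - (K+1)/N\<close>.  If the price were almost surely below
  \<open>c n\<^sup>2\<close> with \<open>c = min (1/3) (p/2)\<close>, then \<open>K \<approx> c N\<close>, so the success probability would be at most
  \<open>1 - (1 - c)\<^sup>2 + o(1)\<close>, which is less than \<open>2 c \<le> p\<close> for large \<open>L\<close>.
\<close>

text \<open>\<open>R u t\<close> is a guess for ``\<open>u\<close> is infected at time \<open>t\<close>''; it is correct if it is locally
  consistent.\<close>
lemma infected_by_eqI:
  assumes fn: "\<And>u t t'. R u t \<Longrightarrow> R u t' \<Longrightarrow> t = t'"
    and seed: "R s t\<^sub>0"
    and step: "\<And>u t. R u t \<Longrightarrow> u \<noteq> s \<Longrightarrow>
      \<exists>v t'. {u, v} \<in> edges G \<and> label G {u, v} = t \<and> R v t' \<and> t' < t \<and> t \<le> t' + \<delta>"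
    and closed: "\<And>u v t'. {u, v} \<in> edges G \<Longrightarrow> R v t' \<Longrightarrow> t' < label G {u, v} \<Longrightarrow>
      label G {u, v} \<le> t' + \<delta> \<Longrightarrow> \<exists>t. R u t \<and> t \<le> label G {u, v}"
  shows "infected_by G \<delta> s t\<^sub>0 t u = Some t' \<longleftrightarrow> R u t' \<and> t' \<le> t"
proof (induction t arbitrary: u t')
  case 0
  have "u = s \<and> t\<^sub>0 = 0" if "R u 0"
    using step[OF that] fn[OF seed] that by blast
  then show ?case using seed by (auto intro!: gr0I)
next
  case (Suc t)
  define I where "I = infected_by G \<delta> s t\<^sub>0 t"
  have IH: "I u = Some t' \<longleftrightarrow> R u t' \<and> t' \<le> t" for u t'
    using Suc.IH by (simp add: I_def)
  have None: "I u = None \<longleftrightarrow> (\<forall>t'. R u t' \<longrightarrow> t < t')"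
    using IH[of u] by (metis not_le option.exhaust option.distinct(1))
  have inf: "infectors G \<delta> I u (Suc t) \<noteq> {} \<longleftrightarrow>
      (\<exists>v t'. {u, v} \<in> edges G \<and> label G {u, v} = Suc t \<and> R v t' \<and> t' < Suc t \<and> Suc t \<le> t' + \<delta>)"
    unfolding infectors_def infectious_def IH using less_Suc_eq_le by auto
  show ?case
  proof (cases "I u")
    case (Some a)
    then have "R u a" "a \<le> t" using IH by auto
    then show ?thesis
      using Some fn by (auto simp: I_def[symmetric])
  next
    case None': None
    have new: "R u (Suc t) \<longleftrightarrow> (u = s \<and> t\<^sub>0 = Suc t) \<or> infectors G \<delta> I u (Suc t) \<noteq> {}"
    proof
      assume "R u (Suc t)"
      then show "(u = s \<and> t\<^sub>0 = Suc t) \<or> infectors G \<delta> I u (Suc t) \<noteq> {}"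
        unfolding inf using fn seed step by blast
    next
      assume "(u = s \<and> t\<^sub>0 = Suc t) \<or> infectors G \<delta> I u (Suc t) \<noteq> {}"
      then show "R u (Suc t)"
      proof
        assume "infectors G \<delta> I u (Suc t) \<noteq> {}"
        then obtain v b where "{u, v} \<in> edges G" "label G {u, v} = Suc t" "R v b"
            "b < Suc t" "Suc t \<le> b + \<delta>"
          unfolding inf by blast
        then obtain a where a: "R u a" "a \<le> Suc t"
          using closed[of u v b] by auto
        with None' None have "t < a" by blast
        with a show ?thesis by (simp add: le_Suc_eq)
      qed (use seed in blast)
    qed
    have "R u t' \<and> t' \<le> Suc t \<longleftrightarrow> R u (Suc t) \<and> t' = Suc t"
      using None' None by (auto simp: le_Suc_eq)
    then show ?thesis
      using None' new by (auto simp: I_def[symmetric])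
  qed
qed

definition hub :: "nat \<Rightarrow> nat \<Rightarrow> nat" where
  "hub g i = 3 * prod_encode (g, i)"

definition relay :: "nat \<Rightarrow> nat" where
  "relay c = 3 * c + 1"

definition centre :: "nat \<Rightarrow> nat" where
  "centre g = 3 * g + 2"

lemma node_simps [simp]:
  "hub g i = hub g' i' \<longleftrightarrow> g = g' \<and> i = i'"
  "relay c = relay c' \<longleftrightarrow> c = c'"
  "centre g = centre g' \<longleftrightarrow> g = g'"
  "hub g i \<noteq> relay c" "relay c \<noteq> hub g i"
  "hub g i \<noteq> centre g'" "centre g' \<noteq> hub g i"
  "relay c \<noteq> centre g" "centre g \<noteq> relay c"
  unfolding hub_def relay_def centre_def by (simp_all, presburger+)

definition hubs :: "nat \<Rightarrow> (nat \<times> nat) set" where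
  "hubs L = {..<L\<^sup>2} \<times> {..<L}"

definition nodes :: "nat \<Rightarrow> nat set" where
  "nodes L = (\<lambda>(g, i). hub g i) ` hubs L \<union> relay ` {..<2 * L\<^sup>2} \<union> centre ` {..<L\<^sup>2}"

lemma finite_hubs [simp]: "finite (hubs L)"
  by (simp add: hubs_def)

lemma card_hubs: "card (hubs L) = L ^ 3"
  by (simp add: hubs_def power2_eq_square power3_eq_cube)

lemma inj_hub: "inj_on (\<lambda>(g, i). hub g i) A"
  by (auto simp: inj_on_def)

lemma finite_nodes [simp]: "finite (nodes L)"
  by (simp add: nodes_def)

lemma card_nodes: "card (nodes L) = L ^ 3 + 3 * L\<^sup>2"
proof -
  have "card (nodes L) = card ((\<lambda>(g, i). hub g i) ` hubs L) + card (relay ` {..<2 * L\<^sup>2})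
      + card (centre ` {..<L\<^sup>2})"
    unfolding nodes_def by (subst card_Un_disjoint; auto simp: card_Un_disjoint)+
  also have "\<dots> = L ^ 3 + 2 * L\<^sup>2 + L\<^sup>2"
    by (subst card_image, rule inj_hub) (simp add: card_image card_hubs inj_on_def)
  finally show ?thesis by simp
qed

text \<open>The labelled edges belonging to segment \<open>g\<close>; \<open>b\<close> is the label relative to the start of
  the time window of the segment.  An edge has only one label, so the relay paths of the
  segments must be edge-disjoint although they share \<open>2 * L\<^sup>2\<close> relays: since
  \<open>(k + 1)\<^sup>2 - k\<^sup>2\<close> determines \<open>k\<close>, an edge of the path \<open>g + 0\<^sup>2, g + 1\<^sup>2, \<dots>, g + L\<^sup>2\<close>
  determines both \<open>k\<close> and \<open>g\<close>.\<close>
inductive active :: "nat \<Rightarrow> nat \<Rightarrow> nat \<Rightarrow> nat \<Rightarrow> nat \<Rightarrow> nat \<Rightarrow> bool" for L s g where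
  source: "i < L \<Longrightarrow> hub g i \<noteq> s \<Longrightarrow> active L s g s (hub g i) (2 * i + 2)"
| entry: "i < L \<Longrightarrow> active L s g (hub g i) (relay (g + i\<^sup>2)) (2 * i + 3)"
| relay: "k < L \<Longrightarrow> active L s g (relay (g + k\<^sup>2)) (relay (g + (Suc k)\<^sup>2)) (2 * k + 5)"
| centre: "active L s g (relay (g + L\<^sup>2)) (centre g) (2 * L + 4)"
| star: "(h, j) \<in> hubs L \<Longrightarrow> active L s g (centre g) (hub h j) (2 * L + 5)"

text \<open>The part of a chain with first victim \<open>hub g i\<close> that does not depend on the source: \<open>u\<close> is
  infected at relative time \<open>b\<close> by \<open>w\<close>.\<close>
inductive infects :: "nat \<Rightarrow> nat \<Rightarrow> nat \<Rightarrow> nat \<Rightarrow> nat \<Rightarrow> nat \<Rightarrow> bool" for L g i where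
  entry: "infects L g i (relay (g + i\<^sup>2)) (2 * i + 3) (hub g i)"
| relay: "i \<le> k \<Longrightarrow> k < L \<Longrightarrow> infects L g i (relay (g + (Suc k)\<^sup>2)) (2 * k + 5) (relay (g + k\<^sup>2))"
| centre: "infects L g i (centre g) (2 * L + 4) (relay (g + L\<^sup>2))"
| star: "(h, j) \<in> hubs L \<Longrightarrow> (h, j) \<noteq> (g, i) \<Longrightarrow> infects L g i (hub h j) (2 * L + 5) (centre g)"

lemma relay_path_inj:
  assumes "g + k\<^sup>2 = g' + k'\<^sup>2" "g + (Suc k)\<^sup>2 = g' + (Suc k')\<^sup>2"
  shows "g = g' \<and> k = (k' :: nat)"
proof -
  have "2 * k + 1 + (g + k\<^sup>2) = 2 * k' + 1 + (g' + k'\<^sup>2)"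
    using assms(2) by (simp add: power2_eq_square)
  then show ?thesis using assms(1) by simp
qed

lemma relay_path_increasing:
  assumes "g + k\<^sup>2 = g' + (Suc k')\<^sup>2" "g + (Suc k)\<^sup>2 = g' + (k'\<^sup>2 :: nat)"
  shows False
proof -
  have "2 * k + 1 + (g + k\<^sup>2) + 2 * k' + 1 = g' + (Suc k')\<^sup>2"
    using assms(2) by (simp add: power2_eq_square)
  then show ?thesis using assms(1) by simp
qed

lemma active_unique:
  assumes "active L (hub gs js) g u v b" "active L (hub gs js) g' u' v' b'" "{u, v} = {u', v'}"
  shows "g = g' \<and> b = b'"
proof -
  from assms(3) have eq: "u = u' \<and> v = v' \<or> u = v' \<and> v = u'"
    by (auto simp: doubleton_eq_iff)
  show ?thesis
    using assms(1)
  proof cases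
    case source
    show ?thesis using assms(2) by cases (use source eq in auto)
  next
    case entry
    show ?thesis using assms(2) by cases (use entry eq in auto)
  next
    case (relay k)
    show ?thesis using assms(2)
    proof cases
      case (relay k')
      have "g + k\<^sup>2 = g' + k'\<^sup>2 \<and> g + (Suc k)\<^sup>2 = g' + (Suc k')\<^sup>2 \<or>
          g + k\<^sup>2 = g' + (Suc k')\<^sup>2 \<and> g + (Suc k)\<^sup>2 = g' + k'\<^sup>2"
        using eq unfolding relay(1,2) \<open>u = relay (g + k\<^sup>2)\<close> \<open>v = relay (g + (Suc k)\<^sup>2)\<close> node_simps(2) .
      then have "g = g' \<and> k = k'"
        using relay_path_inj relay_path_increasing by blast
      then show ?thesis
        using \<open>b = 2 * k + 5\<close> relay(3) by blast
    qed (use relay eq in auto)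
  next
    case centre
    show ?thesis using assms(2) by cases (use centre eq in auto)
  next
    case star
    show ?thesis using assms(2) by cases (use star eq in auto)
  qed
qed

lemma infects_unique:
  assumes "infects L g i u b w" "infects L g i u b' w'"
  shows "b = b' \<and> w = w'"
proof -
  have sq: "k = k'" if "g + (Suc k)\<^sup>2 = g + (Suc k')\<^sup>2" for k k' 
    using that by (metis add_left_cancel nat.inject power2_eq_iff_nonneg zero_le)
  have sq': False if "g + i\<^sup>2 = g + (Suc k)\<^sup>2" "i \<le> k" for k
    using that by (metis Suc_n_not_le_n add_left_cancel power2_eq_iff_nonneg zero_le)
  show ?thesis
    using assms(1)
  proof cases
    case entry
    show ?thesis using assms(2) by cases (use entry sq' in \<open>auto simp del: add_left_cancel power_Suc\<close>)
  next
    case (relay k)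
    show ?thesis using assms(2)
    proof cases
      case (relay k')
      then show ?thesis
        using \<open>u = relay (g + (Suc k)\<^sup>2)\<close> \<open>b = 2 * k + 5\<close> \<open>w = relay (g + k\<^sup>2)\<close> sq[of k k'] by simp
    next
      case entry
      then show ?thesis
        using \<open>u = relay (g + (Suc k)\<^sup>2)\<close> \<open>i \<le> k\<close> sq'[of k] by simp
    qed (use relay in auto)
  next
    case centre
    show ?thesis using assms(2) by cases (use centre in auto)
  next
    case star
    show ?thesis using assms(2) by cases (use star in auto)
  qed
qed

definition start :: "nat \<Rightarrow> nat \<Rightarrow> nat" where
  "start L g = g * (2 * L + 8)"

lemma start_window:
  assumes "start L g + a < start L g' + b" "start L g' + b \<le> start L g + a + 2"
    and "0 < a" "a < 2 * L + 6" "0 < b" "b < 2 * L + 6"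
  shows "g = g' \<and> a < b \<and> b \<le> a + 2"
proof -
  have "start L g + (2 * L + 8) \<le> start L g'" if "g < g'"
    using mult_le_mono1[of "Suc g" g' "2 * L + 8"] that by (simp add: start_def)
  moreover have "start L g' + (2 * L + 8) \<le> start L g" if "g' < g"
    using mult_le_mono1[of "Suc g'" g "2 * L + 8"] that by (simp add: start_def)
  ultimately show ?thesis using assms by (cases g g' rule: linorder_cases) auto
qed

text \<open>All remaining edges of the complete graph get the last time step as label, when no node is
  infectious any more.\<close>
definition game_graph :: "nat \<Rightarrow> nat \<Rightarrow> temporal_graph" where
  "game_graph L s = \<lparr>
     verts = nodes L,
     edges = {{u, v} | u v. u \<in> nodes L \<and> v \<in> nodes L \<and> u \<noteq> v},
     label = (\<lambda>e. if \<exists>g<L\<^sup>2. \<exists>u v b. e = {u, v} \<and> active L s g u v b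
                   then (THE t. \<exists>g<L\<^sup>2. \<exists>u v b. e = {u, v} \<and> active L s g u v b \<and> t = start L g + b)
                   else start L (L\<^sup>2)),
     lifetime = start L (L\<^sup>2)\<rparr>"

lemma game_graph_simps [simp]:
  "verts (game_graph L s) = nodes L"
  "edges (game_graph L s) = {{u, v} | u v. u \<in> nodes L \<and> v \<in> nodes L \<and> u \<noteq> v}"
  "lifetime (game_graph L s) = start L (L\<^sup>2)"
  by (simp_all add: game_graph_def)

lemma label_active:
  assumes "active L (hub gs js) g u v b" "g < L\<^sup>2" "e = {u, v}"
  shows "label (game_graph L (hub gs js)) e = start L g + b"
proof -
  let ?P = "\<lambda>t. \<exists>g<L\<^sup>2. \<exists>u v b. e = {u, v} \<and> active L (hub gs js) g u v b \<and> t = start L g + b"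
  have "?P (start L g + b)" using assms by blast
  moreover have "t = start L g + b" if "?P t" for t
  proof -
    from that obtain g' u' v' b'
      where "e = {u', v'}" "active L (hub gs js) g' u' v' b'" "t = start L g' + b'"
      by blast
    then show ?thesis using active_unique[OF assms(1), of g' u' v' b'] assms(3) by simp
  qed
  ultimately have "(THE t. ?P t) = start L g + b" by (rule the_equality)
  moreover have "\<exists>g<L\<^sup>2. \<exists>u v b. e = {u, v} \<and> active L (hub gs js) g u v b"
    using assms by blast
  ultimately show ?thesis by (simp only: game_graph_def temporal_graph.simps if_True)
qed

lemma label_cases:
  obtains (inert) "label (game_graph L (hub gs js)) {u, v} = start L (L\<^sup>2)"
  | (active) g b where "g < L\<^sup>2" "active L (hub gs js) g u v b \<or> active L (hub gs js) g v u b"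
      "label (game_graph L (hub gs js)) {u, v} = start L g + b"
proof (cases "\<exists>g<L\<^sup>2. \<exists>u' v' b. {u, v} = {u', v'} \<and> active L (hub gs js) g u' v' b")
  case True
  then obtain g u' v' b where *: "g < L\<^sup>2" "{u, v} = {u', v'}" "active L (hub gs js) g u' v' b"
    by blast
  then have "label (game_graph L (hub gs js)) {u, v} = start L g + b"
    by (intro label_active)
  moreover have "active L (hub gs js) g u v b \<or> active L (hub gs js) g v u b"
    using *(2,3) by (auto simp: doubleton_eq_iff)
  ultimately show ?thesis using *(1) active by blast
next
  case False
  show ?thesis
    by (rule inert) (simp only: game_graph_def temporal_graph.simps False if_False)
qed

lemma active_offset: "active L s g u v b \<Longrightarrow> 0 < b \<and> b < 2 * L + 6"
  by (erule active.cases) auto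

lemma active_nodes:
  assumes "active L s g u v b" "g < L\<^sup>2" "s \<in> nodes L"
  shows "u \<in> nodes L \<and> v \<in> nodes L \<and> u \<noteq> v"
proof -
  have "k\<^sup>2 \<le> L\<^sup>2" if "k \<le> L" for k using that by simp
  then have "g + k\<^sup>2 < 2 * L\<^sup>2" if "k \<le> L" for k
    using that assms(2) by (metis add_less_le_mono mult_2)
  then have r: "relay (g + k\<^sup>2) \<in> nodes L" if "k \<le> L" for k
    using that by (simp add: nodes_def)
  have h: "hub h j \<in> nodes L" if "(h, j) \<in> hubs L" for h j
    using that by (force simp: nodes_def)
  have "centre g \<in> nodes L" using assms(2) by (simp add: nodes_def)
  from assms(1) show ?thesis
    by cases (use assms(2,3) r h \<open>centre g \<in> nodes L\<close> in \<open>auto simp: hubs_def Suc_leI less_imp_le\<close>)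
qed

lemma wf_game_graph: "wf_temporal_graph (game_graph L (hub gs js))"
proof -
  have "label (game_graph L (hub gs js)) {u, v} \<in> {1..start L (L\<^sup>2)}"
    if "u \<in> nodes L" for u v
  proof (cases rule: label_cases[of L gs js u v])
    case inert
    have "0 < L" using that by (intro gr0I) (simp add: nodes_def hubs_def)
    then show ?thesis by (simp add: inert start_def)
  next
    case (active g b)
    then have "0 < b \<and> b < 2 * L + 6" using active_offset by blast
    moreover have "start L (Suc g) \<le> start L (L\<^sup>2)"
      unfolding start_def using active(1) by (intro mult_le_mono1) simp
    ultimately show ?thesis using active(3) by (auto simp: start_def)
  qed
  then show ?thesis by (auto simp: wf_temporal_graph_def)
qed

definition infected_at :: "nat \<Rightarrow> nat \<Rightarrow> nat \<Rightarrow> nat \<Rightarrow> nat \<Rightarrow> nat \<Rightarrow> bool" where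
  "infected_at L s g i u b \<longleftrightarrow>
     (if u = s then b = 2 * i + 1 else if u = hub g i then b = 2 * i + 2 else \<exists>w. infects L g i u b w)"

lemma infects_offset: "infects L g i u b w \<Longrightarrow> i < L \<Longrightarrow> 2 * i + 2 < b \<and> b < 2 * L + 6"
  by (erule infects.cases) auto

lemma infected_at_offset: "infected_at L s g i u b \<Longrightarrow> i < L \<Longrightarrow> 2 * i < b \<and> b < 2 * L + 6"
  by (auto simp: infected_at_def split: if_splits dest: infects_offset)

lemma infected_at_unique: "infected_at L s g i u b \<Longrightarrow> infected_at L s g i u b' \<Longrightarrow> b = b'"
  by (auto simp: infected_at_def split: if_splits dest: infects_unique)

lemma infected_at_relay:
  assumes "i \<le> k" "k \<le> L"
  shows "infected_at L (hub gs js) g i (relay (g + k\<^sup>2)) (2 * k + 3)"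
proof (cases "k = i")
  case True
  then show ?thesis using infects.entry[of L g i] by (auto simp: infected_at_def)
next
  case False
  then obtain k' where "k = Suc k'" "i \<le> k'" "k' < L" using assms by (cases k) auto
  moreover have "2 * Suc k' + 3 = 2 * k' + 5" by simp
  ultimately show ?thesis
    using infects.relay[of i k' L g] unfolding infected_at_def by (metis node_simps(5))
qed

lemma infected_at_relayD:
  assumes "infected_at L (hub gs js) g i (relay (g + k\<^sup>2)) b" "i < L"
  shows "i \<le> k \<and> k \<le> L \<and> b = 2 * k + 3"
proof -
  obtain w where "infects L g i (relay (g + k\<^sup>2)) b w"
    using assms by (auto simp: infected_at_def)
  then show ?thesis
    by cases (use assms(2) in \<open>auto simp del: power_Suc\<close>)
qed

lemma infected_at_centre: "infected_at L (hub gs js) g i (centre g) (2 * L + 4)"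
  using infects.centre[of L g i] by (auto simp: infected_at_def)

lemma infected_at_hub:
  assumes "(h, j) \<in> hubs L" "i < L"
  shows "\<exists>b. infected_at L (hub gs js) g i (hub h j) b \<and> b \<le> 2 * L + 5"
proof (cases "hub h j \<in> {hub gs js, hub g i}")
  case True
  then show ?thesis using assms(2) by (cases "hub h j = hub gs js") (auto simp: infected_at_def)
next
  case False
  then show ?thesis using infects.star[OF assms(1), of g i] by (auto simp: infected_at_def)
qed

definition parent :: "nat \<Rightarrow> nat \<Rightarrow> nat \<Rightarrow> nat \<Rightarrow> nat \<Rightarrow> nat" where
  "parent L s g i u = (if u = hub g i then s else SOME w. \<exists>b. infects L g i u b w)"

lemma infected_at_parent:
  assumes "infected_at L (hub gs js) g i u b" "u \<noteq> hub gs js" "i < L"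
  shows "\<exists>a. active L (hub gs js) g (parent L (hub gs js) g i u) u b \<and>
    infected_at L (hub gs js) g i (parent L (hub gs js) g i u) a \<and> a < b \<and> b \<le> a + 2"
proof (cases "u = hub g i")
  case True
  then show ?thesis
    using assms active.source[of i L g "hub gs js"]
    by (auto simp: infected_at_def parent_def)
next
  case False
  then obtain w where w: "infects L g i u b w"
    using assms by (auto simp: infected_at_def)
  have "(SOME w. \<exists>b. infects L g i u b w) = w"
    by (rule some_equality) (use w infects_unique in blast)+
  with False have p: "parent L (hub gs js) g i u = w" by (simp add: parent_def)
  have "\<exists>a. active L (hub gs js) g w u b \<and> infected_at L (hub gs js) g i w a \<and> a < b \<and> b \<le> a + 2"
    using w
  proof cases
    case entry
    then show ?thesis using active.entry[OF assms(3), of "hub gs js" g]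
      by (cases "w = hub gs js") (auto simp: infected_at_def)
  next
    case (relay k)
    then show ?thesis
      using active.relay[of k L "hub gs js" g] infected_at_relay[of i k L gs js g] by fastforce
  next
    case centre
    then show ?thesis
      using active.centre[of L "hub gs js" g] infected_at_relay[of i L L gs js g] assms(3) by fastforce
  next
    case (star h j)
    then show ?thesis
      using active.star[of h j L "hub gs js" g] infected_at_centre[of L gs js g i] by fastforce
  qed
  with p show ?thesis by simp
qed

lemma infected_at_closed:
  assumes act: "active L (hub gs js) g u v b \<or> active L (hub gs js) g v u b"
    and v: "infected_at L (hub gs js) g i v a" and ab: "a < b" "b \<le> a + 2" and "i < L"
  shows "\<exists>b'. infected_at L (hub gs js) g i u b' \<and> b' \<le> b"
proof (cases "u = hub gs js")
  case True
  have "2 * i + 1 \<le> b" using infected_at_offset[OF v \<open>i < L\<close>] ab by simp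
  then show ?thesis using True by (auto simp: infected_at_def)
next
  case u: False
  from act show ?thesis
  proof
    assume "active L (hub gs js) g u v b"
    then show ?thesis
    proof cases
      case source
      then show ?thesis using u by simp
    next
      case (entry i')
      then show ?thesis using infected_at_relayD[of L gs js g i i' a] v ab \<open>i < L\<close> by auto
    next
      case (relay k)
      then show ?thesis using infected_at_relayD[of L gs js g i "Suc k" a] v ab \<open>i < L\<close> by auto
    next
      case centre
      then show ?thesis using infected_at_unique[OF infected_at_centre v[unfolded centre(2)]] ab by simp
    next
      case star
      then show ?thesis using infected_at_centre[of L gs js g i] by fastforce
    qed
  next
    assume "active L (hub gs js) g v u b"
    then show ?thesis
    proof cases
      case (source i')
      then have "a = 2 * i + 1" using v by (simp add: infected_at_def)
      then have "i' = i" using source ab by linarith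
      then show ?thesis using source u by (auto simp: infected_at_def)
    next
      case (entry i')
      have "i' = i"
      proof (rule ccontr)
        assume "i' \<noteq> i"
        then consider "v = hub gs js" "a = 2 * i + 1" | w where "infects L g i (hub g i') a w"
          using v entry(1) by (auto simp: infected_at_def split: if_splits)
        then show False
        proof cases
          case 1
          then show ?thesis using entry ab \<open>i' \<noteq> i\<close> by linarith
        next
          case 2
          then show ?thesis by cases (use entry ab in auto)
        qed
      qed
      then show ?thesis using entry infected_at_relay[of i i L gs js g] \<open>i < L\<close> by fastforce
    next
      case (relay k)
      then have "i \<le> k" using infected_at_relayD[of L gs js g i k a] v \<open>i < L\<close> by auto
      then show ?thesis using infected_at_relay[of i "Suc k" L gs js g] relay by fastforce
    next
      case centre
      then show ?thesis using infected_at_centre[of L gs js g i] by fastforce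
    next
      case star
      then show ?thesis using infected_at_hub \<open>i < L\<close> by blast
    qed
  qed
qed

text \<open>The pair \<open>r k\<close> names the hub that the source infects in round \<open>k\<close>.  It may be the source
  itself; the seed time is then the same, and the source takes over the role of the hub.\<close>
definition game_adversary :: "nat \<Rightarrow> nat \<times> nat \<Rightarrow> (nat \<Rightarrow> nat \<times> nat) \<Rightarrow> adversary" where
  "game_adversary L \<sigma> r = \<lparr>
     graph = game_graph L (hub (fst \<sigma>) (snd \<sigma>)),
     duration = 2,
     source = hub (fst \<sigma>) (snd \<sigma>),
     seed_time = (\<lambda>k. start L (fst (r k)) + (2 * snd (r k) + 1)),
     infector = (\<lambda>k. parent L (hub (fst \<sigma>) (snd \<sigma>)) (fst (r k)) (snd (r k)))\<rparr>"

lemma game_adversary_simps [simp]: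
  "graph (game_adversary L \<sigma> r) = game_graph L (hub (fst \<sigma>) (snd \<sigma>))"
  "duration (game_adversary L \<sigma> r) = 2"
  "source (game_adversary L \<sigma> r) = hub (fst \<sigma>) (snd \<sigma>)"
  "seed_time (game_adversary L \<sigma> r) k = start L (fst (r k)) + (2 * snd (r k) + 1)"
  "infector (game_adversary L \<sigma> r) k u = parent L (hub (fst \<sigma>) (snd \<sigma>)) (fst (r k)) (snd (r k)) u"
  by (simp_all add: game_adversary_def)

lemma start_lifetime:
  assumes "g < L\<^sup>2" shows "start L g + (2 * L + 8) \<le> start L (L\<^sup>2)"
  using mult_le_mono1[of "Suc g" "L\<^sup>2" "2 * L + 8"] assms by (simp add: start_def)

lemma parent_edge:
  assumes "(gs, js) \<in> hubs L" "(g, i) \<in> hubs L"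
    and "infected_at L (hub gs js) g i u b" "u \<noteq> hub gs js"
  defines "v \<equiv> parent L (hub gs js) g i u"
  shows "\<exists>a. {u, v} \<in> edges (game_graph L (hub gs js)) \<and>
    label (game_graph L (hub gs js)) {u, v} = start L g + b \<and>
    infected_at L (hub gs js) g i v a \<and> a < b \<and> b \<le> a + 2"
proof -
  have g: "g < L\<^sup>2" "i < L" using assms(2) by (auto simp: hubs_def)
  obtain a where a: "active L (hub gs js) g v u b"
      "infected_at L (hub gs js) g i v a" "a < b" "b \<le> a + 2"
    using infected_at_parent[OF assms(3,4) g(2)] unfolding v_def by blast
  have "hub gs js \<in> nodes L" using assms(1) by (force simp: nodes_def)
  then have "{u, v} \<in> edges (game_graph L (hub gs js))"
    using active_nodes[OF a(1) g(1)] by auto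
  moreover have "label (game_graph L (hub gs js)) {u, v} = start L g + b"
    using a(1) g(1) by (rule label_active) auto
  ultimately show ?thesis using a by blast
qed

lemma infection_times_game:
  assumes "\<sigma> \<in> hubs L" "r k \<in> hubs L"
  shows "infection_times (game_adversary L \<sigma> r) k u = Some t \<longleftrightarrow>
    (\<exists>b. t = start L (fst (r k)) + b \<and>
      infected_at L (hub (fst \<sigma>) (snd \<sigma>)) (fst (r k)) (snd (r k)) u b)"
proof -
  obtain gs js g i where eq: "\<sigma> = (gs, js)" "r k = (g, i)" by fastforce
  note hubs = assms[unfolded eq]
  have g: "g < L\<^sup>2" "i < L" using hubs(2) by (auto simp: hubs_def)
  let ?s = "hub gs js" and ?G = "game_graph L (hub gs js)"
  define R where "R u t \<longleftrightarrow> (\<exists>b. t = start L g + b \<and> infected_at L ?s g i u b)" for u t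
  have "infected_by ?G 2 ?s (start L g + (2 * i + 1)) t u = Some t' \<longleftrightarrow> R u t' \<and> t' \<le> t" for t u t'
  proof (rule infected_by_eqI)
    show "t = t'" if "R u t" "R u t'" for u t t'
      using that infected_at_unique unfolding R_def by blast
    show "R ?s (start L g + (2 * i + 1))"
      by (simp add: R_def infected_at_def)
  next
    fix u t assume "R u t" "u \<noteq> ?s"
    then obtain b where "t = start L g + b" "infected_at L ?s g i u b" by (auto simp: R_def)
    moreover obtain v a where "{u, v} \<in> edges ?G" "label ?G {u, v} = start L g + b"
        "infected_at L ?s g i v a" "a < b" "b \<le> a + 2"
      using parent_edge[OF hubs calculation(2) \<open>u \<noteq> ?s\<close>] by blast
    ultimately show "\<exists>v t'. {u, v} \<in> edges ?G \<and> label ?G {u, v} = t \<and> R v t' \<and> t' < t \<and> t \<le> t' + 2"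
      unfolding R_def by (intro exI[of _ v] exI[of _ "start L g + a"]) auto
  next
    fix u v t'
    assume "R v t'" and lt: "t' < label ?G {u, v}" "label ?G {u, v} \<le> t' + 2"
    then obtain a where a: "t' = start L g + a" "infected_at L ?s g i v a" by (auto simp: R_def)
    then have a': "0 < a" "a < 2 * L + 6" using infected_at_offset[OF a(2) g(2)] by auto
    show "\<exists>t. R u t \<and> t \<le> label ?G {u, v}"
    proof (cases rule: label_cases[of L gs js u v])
      case inert
      then show ?thesis using lt a a' start_lifetime[OF g(1)] by linarith
    next
      case (active g' b)
      then have "0 < b" "b < 2 * L + 6" using active_offset by blast+
      then have "g = g' \<and> a < b \<and> b \<le> a + 2"
        using start_window[of L g a g' b] lt a a' active(3) by simp
      moreover from this obtain b' where "infected_at L ?s g i u b'" "b' \<le> b"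
        using infected_at_closed[OF _ a(2)] active(2) g(2) by blast
      ultimately show ?thesis
        unfolding R_def active(3) by (intro exI[of _ "start L g + b'"]) auto
    qed
  qed
  moreover have "t \<le> start L (L\<^sup>2)" if "R u t" for u t
  proof -
    from that obtain b where b: "t = start L g + b" "infected_at L ?s g i u b"
      by (auto simp: R_def)
    show ?thesis
      using infected_at_offset[OF b(2) g(2)] b(1) start_lifetime[OF g(1)] by simp
  qed
  ultimately show ?thesis
    unfolding infection_times_def by (auto simp: eq R_def)
qed

lemma wf_game_adversary:
  assumes "\<sigma> \<in> hubs L" "\<And>k. r k \<in> hubs L"
  shows "wf_adversary (game_adversary L \<sigma> r)"
proof -
  obtain gs js where \<sigma>: "\<sigma> = (gs, js)" by fastforce
  have "start L (fst (r k)) + (2 * snd (r k) + 1) \<le> start L (L\<^sup>2)" for k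
    using assms(2)[of k] start_lifetime[of "fst (r k)" L] by (auto simp: hubs_def)
  moreover have "hub gs js \<in> nodes L" using assms(1) by (force simp: nodes_def \<sigma>)
  moreover have "parent L (hub gs js) (fst (r k)) (snd (r k)) u \<in>
      infectors (game_graph L (hub gs js)) 2 (infection_times (game_adversary L \<sigma> r) k) u t"
    if inf: "infection_times (game_adversary L \<sigma> r) k u = Some t" and u: "u \<noteq> hub gs js" for k u t
  proof -
    obtain g i where r: "r k = (g, i)" by fastforce
    obtain b where b: "t = start L g + b" "infected_at L (hub gs js) g i u b"
      using inf unfolding infection_times_game[of \<sigma> L r k, OF assms(1) assms(2)]
      by (auto simp: \<sigma> r)
    let ?v = "parent L (hub gs js) g i u"
    obtain a where a: "{u, ?v} \<in> edges (game_graph L (hub gs js))"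
       "label (game_graph L (hub gs js)) {u, ?v} = start L g + b"
       "infected_at L (hub gs js) g i ?v a" "a < b" "b \<le> a + 2"
      using parent_edge[of gs js L g i u b] assms(1) assms(2)[of k] b(2) u
      by (auto simp: \<sigma> r)
    have "infection_times (game_adversary L \<sigma> r) k ?v = Some (start L g + a)"
      using a(3) unfolding infection_times_game[of \<sigma> L r k, OF assms(1) assms(2)]
      by (auto simp: \<sigma> r)
    then show ?thesis
      using a b(1) by (auto simp: infectors_def infectious_def r simp del: game_graph_simps)
  qed
  ultimately show ?thesis
    using wf_game_graph by (auto simp: wf_adversary_def \<sigma>)
qed

lemma card_infected_game:
  assumes "\<sigma> \<in> hubs L" "r k \<in> hubs L"
  shows "L ^ 3 \<le> card (dom (infection_times (game_adversary L \<sigma> r) k))"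
proof -
  obtain gs js g i where eq: "\<sigma> = (gs, js)" "r k = (g, i)" by fastforce
  have g: "(g, i) \<in> hubs L" "i < L" using assms(2) by (auto simp: hubs_def eq)
  let ?D = "dom (infection_times (game_adversary L \<sigma> r) k)"
  have D: "?D = {u. \<exists>b. infected_at L (hub gs js) g i u b}"
    using infection_times_game[of \<sigma> L r k, OF assms] by (auto simp: eq dom_def)
  have "?D \<subseteq> nodes L"
  proof
    fix u assume "u \<in> ?D"
    then obtain b where b: "infected_at L (hub gs js) g i u b" using D by auto
    have s: "hub gs js \<in> nodes L" using assms(1) by (force simp: nodes_def eq)
    show "u \<in> nodes L"
    proof (cases "u = hub gs js")
      case False
      then show ?thesis
        using infected_at_parent[OF b False g(2)] active_nodes s g(1) by (auto simp: hubs_def)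
    qed (use s in simp)
  qed
  then have "finite ?D" using finite_nodes finite_subset by blast
  moreover have "(\<lambda>(g, i). hub g i) ` hubs L \<subseteq> ?D"
    unfolding D using infected_at_hub g(2) by fastforce
  ultimately have "card ((\<lambda>(g, i). hub g i) ` hubs L) \<le> card ?D"
    by (intro card_mono)
  then show ?thesis by (simp add: card_image[OF inj_hub] card_hubs)
qed

definition default_observation :: "nat \<Rightarrow> nat \<times> nat \<Rightarrow> nat \<Rightarrow> observation" where
  "default_observation L v u =
     (if \<exists>b w. infects L (fst v) (snd v) u b w
      then Infected_By (start L (fst v) + (THE b. \<exists>w. infects L (fst v) (snd v) u b w))
             (SOME w. \<exists>b. infects L (fst v) (snd v) u b w)
      else Not_Infected)"

lemma observe_game:
  assumes "\<sigma> \<in> hubs L" "r k \<in> hubs L"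
    and "u \<noteq> hub (fst \<sigma>) (snd \<sigma>)" "u \<noteq> hub (fst (r k)) (snd (r k))"
  shows "observe (game_adversary L \<sigma> r) k u = default_observation L (r k) u"
proof -
  obtain g i where r: "r k = (g, i)" by fastforce
  have times: "infection_times (game_adversary L \<sigma> r) k u = Some t \<longleftrightarrow>
      (\<exists>b w. t = start L g + b \<and> infects L g i u b w)" for t
    using infection_times_game[of \<sigma> L r k, OF assms(1,2)] assms(3,4)
    by (auto simp: r infected_at_def)
  show ?thesis
  proof (cases "\<exists>b w. infects L g i u b w")
    case True
    then obtain b w where bw: "infects L g i u b w" by blast
    then have "(THE b. \<exists>w. infects L g i u b w) = b"
      using infects_unique by blast
    moreover have "infection_times (game_adversary L \<sigma> r) k u = Some (start L g + b)"
      using times bw by blast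
    ultimately show ?thesis
      using assms(3,4) True by (simp add: observe_def default_observation_def r parent_def)
  next
    case False
    then have "infection_times (game_adversary L \<sigma> r) k u = None"
      using times by (cases "infection_times (game_adversary L \<sigma> r) k u") auto
    then show ?thesis using False by (simp add: observe_def default_observation_def r)
  qed
qed

lemma card_avoiding_lists:
  assumes "finite A"
  shows "(card A - 1) ^ K \<le>
    card {xs. length xs = K \<and> set xs \<subseteq> A \<and> (\<forall>k<K. xs ! k \<noteq> b (take k xs))}"
proof (induction K)
  case 0
  have "{xs. length xs = 0 \<and> set xs \<subseteq> A \<and> (\<forall>k<0. xs ! k \<noteq> b (take k xs))} = {[]}" by auto
  then show ?case by simp
next
  case (Suc K)
  let ?S = "\<lambda>K. {xs. length xs = K \<and> set xs \<subseteq> A \<and> (\<forall>k<K. xs ! k \<noteq> b (take k xs))}"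
  let ?T = "SIGMA xs : ?S K. A - {b xs}"
  have fin: "finite (?S K)" for K
    by (rule finite_subset[OF _ finite_lists_length_eq[OF assms, of K]]) auto
  have "(card A - 1) ^ Suc K \<le> (\<Sum>xs\<in>?S K. card A - 1)"
    using Suc.IH by simp
  also have "\<dots> \<le> (\<Sum>xs\<in>?S K. card (A - {b xs}))"
    by (intro sum_mono) (simp add: card_Diff_singleton_if)
  also have "\<dots> = card ?T"
    using fin assms by (simp add: card_SigmaI)
  also have "\<dots> = card ((\<lambda>(xs, x). xs @ [x]) ` ?T)"
    by (rule card_image[symmetric]) (auto simp: inj_on_def)
  also have "\<dots> \<le> card (?S (Suc K))"
    by (rule card_mono[OF fin]) (auto simp: nth_append less_Suc_eq)
  finally show ?case .
qed

definition choice :: "strategy \<Rightarrow> nat \<Rightarrow> observation list \<Rightarrow> action" where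
  "choice S L = S (nodes L) {{u, v} | u v. u \<in> nodes L \<and> v \<in> nodes L \<and> u \<noteq> v} (start L (L\<^sup>2)) 2"

lemma act_game: "act S (game_adversary L \<sigma> r) h = choice S L h"
  by (simp add: act_def choice_def)

definition default_history :: "strategy \<Rightarrow> nat \<Rightarrow> (nat \<times> nat) list \<Rightarrow> observation list" where
  "default_history S L = foldl (\<lambda>h v. case choice S L h of
     Watch u \<Rightarrow> h @ [default_observation L v u] | Name u \<Rightarrow> h) []"

definition schedule :: "(nat \<times> nat) list \<Rightarrow> nat \<Rightarrow> nat \<times> nat" where
  "schedule xs k = (if k < length xs then xs ! k else (0, 0))"

lemma schedule_in_hubs:
  assumes "set xs \<subseteq> hubs L" "0 < L" shows "schedule xs k \<in> hubs L"
  using assms nth_mem[of k xs] by (auto simp: schedule_def hubs_def)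

primrec target :: "action \<Rightarrow> nat" where
  "target (Watch u) = u"
| "target (Name u) = u"

lemma history_game:
  assumes "\<sigma> \<in> hubs L" "set xs \<subseteq> hubs L" "0 < L"
    and source: "\<And>k. k \<le> length xs \<Longrightarrow>
      target (choice S L (default_history S L (take k xs))) \<noteq> hub (fst \<sigma>) (snd \<sigma>)"
    and avoid: "\<And>k. k < length xs \<Longrightarrow>
      target (choice S L (default_history S L (take k xs))) \<noteq> hub (fst (xs ! k)) (snd (xs ! k))"
    and "k \<le> length xs"
  shows "history S (game_adversary L \<sigma> (schedule xs)) k = default_history S L (take k xs)"
  using \<open>k \<le> length xs\<close>
proof (induction k)
  case 0
  then show ?case by (simp add: default_history_def)
next
  case (Suc k)
  let ?h = "default_history S L (take k xs)"
  have k: "k < length xs" using Suc.prems by simp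
  have "default_history S L (take (Suc k) xs) = (case choice S L ?h of
      Watch u \<Rightarrow> ?h @ [default_observation L (xs ! k) u] | Name u \<Rightarrow> ?h)"
    unfolding take_Suc_conv_app_nth[OF k] default_history_def by simp
  moreover have "observe (game_adversary L \<sigma> (schedule xs)) k u = default_observation L (xs ! k) u"
    if "choice S L ?h = Watch u" for u
    using observe_game[of \<sigma> L "schedule xs" k u, OF assms(1) schedule_in_hubs[OF assms(2,3)]]
      source[of k] avoid[of k] that k by (simp add: schedule_def)
  ultimately show ?case
    using Suc.IH k by (simp add: act_game split: action.split)
qed

lemma history_stable:
  assumes "act S A (history S A m) = Name v" "m \<le> k"
  shows "history S A k = history S A m"
  using assms(2) by (induction k rule: dec_induct) (use assms(1) in auto)

lemma not_wins_game:
  assumes "\<sigma> \<in> hubs L" "set xs \<subseteq> hubs L" "0 < L"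
    and source: "\<And>k. k \<le> length xs \<Longrightarrow>
      target (choice S L (default_history S L (take k xs))) \<noteq> hub (fst \<sigma>) (snd \<sigma>)"
    and avoid: "\<And>k. k < length xs \<Longrightarrow>
      target (choice S L (default_history S L (take k xs))) \<noteq> hub (fst (xs ! k)) (snd (xs ! k))"
    and stop: "m < length xs" "\<not> plays_round S (game_adversary L \<sigma> (schedule xs)) m"
  shows "\<not> wins S (game_adversary L \<sigma> (schedule xs))"
proof
  let ?A = "game_adversary L \<sigma> (schedule xs)"
  assume "wins S ?A"
  then obtain k where k: "act S ?A (history S ?A k) = Name (source ?A)"
    by (auto simp: wins_def names_def)
  obtain v where v: "act S ?A (history S ?A m) = Name v"
    using stop(2) by (cases "act S ?A (history S ?A m)") (auto simp: plays_round_def)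
  have "act S ?A (history S ?A (min k m)) = Name (source ?A)"
    using k history_stable[OF v, of k] by (auto simp: min_def)
  moreover have "history S ?A (min k m) = default_history S L (take (min k m) xs)"
    using stop(1) by (intro history_game assms) auto
  ultimately show False
    using source[of "min k m"] stop(1) by (simp add: act_game min.coboundedI2)
qed

definition hub_lists :: "nat \<Rightarrow> nat \<Rightarrow> (nat \<times> nat) list set" where
  "hub_lists L K = {xs. set xs \<subseteq> hubs L \<and> length xs = K}"

lemma finite_hub_lists [simp]: "finite (hub_lists L K)"
  and card_hub_lists: "card (hub_lists L K) = (L ^ 3) ^ K"
  by (simp_all add: hub_lists_def finite_lists_length_eq card_lists_length_eq card_hubs)

lemma card_wins_game:
  assumes "0 < L"
    and stop: "\<And>\<sigma> xs. \<sigma> \<in> hubs L \<Longrightarrow> xs \<in> hub_lists L K \<Longrightarrow>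
      \<exists>m<K. \<not> plays_round S (game_adversary L \<sigma> (schedule xs)) m"
  shows "card {(\<sigma>, xs) \<in> hubs L \<times> hub_lists L K. wins S (game_adversary L \<sigma> (schedule xs))}
      + (L ^ 3 - 1) ^ K * (L ^ 3 - (K + 1)) \<le> L ^ 3 * (L ^ 3) ^ K"
proof -
  define t where "t xs = target (choice S L (default_history S L xs))" for xs
  define b where "b xs = inv (\<lambda>(g, i). hub g i) (t xs)" for xs
  have hub_b: "t xs \<noteq> hub (fst v) (snd v)" if "v \<noteq> b xs" for v xs
  proof
    assume "t xs = hub (fst v) (snd v)"
    then have "b xs = inv (\<lambda>(g, i). hub g i) ((\<lambda>(g, i). hub g i) v)"
      by (simp add: b_def split_beta)
    then show False using that inv_f_f[OF inj_hub, of v] by simp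
  qed
  let ?Av = "{xs. length xs = K \<and> set xs \<subseteq> hubs L \<and> (\<forall>k<K. xs ! k \<noteq> b (take k xs))}"
  let ?W = "{(\<sigma>, xs) \<in> hubs L \<times> hub_lists L K. wins S (game_adversary L \<sigma> (schedule xs))}"
  let ?F = "\<lambda>xs. hubs L - (\<lambda>k. b (take k xs)) ` {..K}"
  let ?N = "(\<lambda>(xs, \<sigma>). (\<sigma>, xs)) ` (SIGMA xs : ?Av. ?F xs)"
  have fin: "finite ?Av"
    by (rule finite_subset[OF _ finite_hub_lists[of L K]]) (auto simp: hub_lists_def)
  have "L ^ 3 - (K + 1) \<le> card (?F xs)" for xs
  proof -
    have "card ((\<lambda>k. b (take k xs)) ` {..K}) \<le> K + 1"
      using card_image_le[of "{..K}" "\<lambda>k. b (take k xs)"] by simp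
    then show ?thesis
      using diff_card_le_card_Diff[of "(\<lambda>k. b (take k xs)) ` {..K}" "hubs L"] card_hubs[of L] by simp
  qed
  then have "(L ^ 3 - 1) ^ K * (L ^ 3 - (K + 1)) \<le> (\<Sum>xs\<in>?Av. card (?F xs))"
    using card_avoiding_lists[OF finite_hubs, of L K b] sum_mono[of ?Av "\<lambda>_. L ^ 3 - (K + 1)"]
    by (simp add: card_hubs) (meson le_trans mult_le_mono1)
  also have "\<dots> = card (SIGMA xs : ?Av. ?F xs)"
    using fin by (simp add: card_SigmaI)
  also have "\<dots> = card ?N"
    by (rule card_image[symmetric]) (auto simp: inj_on_def)
  finally have N: "(L ^ 3 - 1) ^ K * (L ^ 3 - (K + 1)) \<le> card ?N" .
  have "?N \<inter> ?W = {}"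
  proof -
    have "\<not> wins S (game_adversary L \<sigma> (schedule xs))" if xs: "xs \<in> ?Av" and \<sigma>: "\<sigma> \<in> ?F xs" for xs \<sigma>
    proof -
      have xs: "set xs \<subseteq> hubs L" "length xs = K" "\<And>k. k < K \<Longrightarrow> xs ! k \<noteq> b (take k xs)"
        using xs by auto
      obtain m where "m < K" "\<not> plays_round S (game_adversary L \<sigma> (schedule xs)) m"
        using stop[of \<sigma> xs] \<sigma> xs by (auto simp: hub_lists_def)
      moreover have "t (take k xs) \<noteq> hub (fst \<sigma>) (snd \<sigma>)" if "k \<le> K" for k
        using \<sigma> that by (intro hub_b) auto
      moreover have "t (take k xs) \<noteq> hub (fst (xs ! k)) (snd (xs ! k))" if "k < K" for k
        using xs that by (intro hub_b) auto
      ultimately show ?thesis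
        using \<sigma> xs assms(1) by (intro not_wins_game[of \<sigma> L xs S m]) (auto simp: t_def)
    qed
    then show ?thesis by auto
  qed
  moreover have "finite ?W"
    by (rule finite_subset[of _ "hubs L \<times> hub_lists L K"]) auto
  ultimately have "card ?N + card ?W = card (?N \<union> ?W)"
    using fin by (intro card_Un_disjoint[symmetric]) auto
  also have "\<dots> \<le> card (hubs L \<times> hub_lists L K)"
  proof (rule card_mono)
    have "?Av \<subseteq> hub_lists L K" by (auto simp: hub_lists_def)
    then show "?N \<union> ?W \<subseteq> hubs L \<times> hub_lists L K" by auto
  qed simp
  also have "\<dots> = L ^ 3 * (L ^ 3) ^ K"
    by (simp add: card_cartesian_product card_hubs card_hub_lists)
  finally show ?thesis using N by linarith
qed

instance observation :: countable
  by countable_datatype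

instance action :: countable
  by countable_datatype

lemma measurable_act_history:
  assumes "discoverer M D" "wf_adversary A"
  shows "(\<lambda>\<omega>. act (D \<omega>) A (history (D \<omega>) A k)) \<in> measurable M (count_space UNIV)"
proof -
  have act: "(\<lambda>\<omega>. act (D \<omega>) A h) \<in> measurable M (count_space UNIV)" for h
    using assms by (simp add: discoverer_def)
  have "(\<lambda>\<omega>. history (D \<omega>) A k) \<in> measurable M (count_space UNIV)"
  proof (induction k)
    case (Suc k)
    have "(\<lambda>\<omega>. case act (D \<omega>) A h of Watch v \<Rightarrow> h @ [observe A k v] | Name v \<Rightarrow> h)
        \<in> measurable M (count_space UNIV)" for h
      by (rule measurable_compose[OF act]) simp
    from measurable_compose_countable[OF this Suc] show ?case by simp
  qed simp
  from measurable_compose_countable[OF act this] show ?thesis .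
qed

lemma measurable_price:
  assumes "discoverer M D" "wf_adversary A"
  shows "(\<lambda>\<omega>. price (D \<omega>) A) \<in> borel_measurable M"
proof -
  have "Measurable.pred M (\<lambda>\<omega>. plays_round (D \<omega>) A k)" for k
    unfolding plays_round_def
    by (rule measurable_compose[OF measurable_act_history[OF assms]]) simp
  then show ?thesis unfolding price_def by measurable
qed

lemma price_ge_rounds:
  assumes "\<And>k. k < K \<Longrightarrow> plays_round S A k" "\<And>k. N \<le> card (dom (infection_times A k))"
  shows "of_nat (K * N) \<le> price S A"
proof -
  have "of_nat (K * N) = (\<Sum>k<K. of_nat N :: ennreal)" by simp
  also have "\<dots> \<le> (\<Sum>k<K. if plays_round S A k then of_nat (card (dom (infection_times A k))) else 0)"
    using assms by (intro sum_mono) simp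
  also have "\<dots> \<le> price S A"
    unfolding price_def by (intro sum_le_suminf) auto
  finally show ?thesis .
qed

lemma price_game:
  assumes "discoverer M D" "solves_source_detection M D p" "0 < p" "0 < L"
    and x: "x \<le> real (K * L ^ 3)"
    and small: "real (L ^ 3 * (L ^ 3) ^ K) - real ((L ^ 3 - 1) ^ K * (L ^ 3 - (K + 1)))
      < p * real (L ^ 3 * (L ^ 3) ^ K)"
  shows "\<exists>\<sigma>\<in>hubs L. \<exists>r. (\<forall>k. r k \<in> hubs L) \<and>
    0 < measure M {\<omega> \<in> space M. ennreal x \<le> price (D \<omega>) (game_adversary L \<sigma> r)}"
proof (rule ccontr)
  assume neg: "\<not> ?thesis"
  interpret prob_space M using assms(1) by (simp add: discoverer_def)
  define P where "P = hubs L \<times> hub_lists L K"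
  define A where "A = (\<lambda>(\<sigma>, xs). game_adversary L \<sigma> (schedule xs))"
  have finP: "finite P" by (simp add: P_def)
  have cardP: "card P = L ^ 3 * (L ^ 3) ^ K"
    by (simp add: P_def card_cartesian_product card_hubs card_hub_lists)
  have wf: "wf_adversary (A q)" if "q \<in> P" for q
    using that schedule_in_hubs[OF _ \<open>0 < L\<close>] wf_game_adversary
    by (auto simp: P_def A_def hub_lists_def)
  have cheap: "AE \<omega> in M. \<not> ennreal x \<le> price (D \<omega>) (A q)" if "q \<in> P" for q
  proof -
    note [measurable] = measurable_price[OF assms(1) wf[OF that]]
    have "prob {\<omega> \<in> space M. ennreal x \<le> price (D \<omega>) (A q)} \<le> 0"
      using neg that schedule_in_hubs[OF _ \<open>0 < L\<close>]
      by (auto simp: P_def A_def hub_lists_def not_less)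
    then have "prob {\<omega> \<in> space M. ennreal x \<le> price (D \<omega>) (A q)} = 0"
      using measure_nonneg[of M "{\<omega> \<in> space M. ennreal x \<le> price (D \<omega>) (A q)}"] by linarith
    then show ?thesis
      by (subst (asm) prob_eq_0) auto
  qed
  let ?W = "\<lambda>q. {\<omega> \<in> space M. wins (D \<omega>) (A q)}"
  have win: "p \<le> prob (?W q)" if "q \<in> P" for q
    using assms(2) wf[OF that] by (simp add: solves_source_detection_def)
  have sets: "?W q \<in> sets M" if "q \<in> P" for q
    using win[OF that] \<open>0 < p\<close> measure_notin_sets[of "?W q" M] by fastforce
  have "AE \<omega> in M. \<forall>q\<in>P. \<not> ennreal x \<le> price (D \<omega>) (A q)"
    using cheap finP by (intro AE_finite_allI)
  then have few: "AE \<omega> in M. (\<Sum>q\<in>P. indicator (?W q) \<omega>)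
      \<le> real (L ^ 3 * (L ^ 3) ^ K) - real ((L ^ 3 - 1) ^ K * (L ^ 3 - (K + 1)))"
  proof (eventually_elim)
    case (elim \<omega>)
    have stop: "\<exists>m<K. \<not> plays_round (D \<omega>) (game_adversary L \<sigma> (schedule xs)) m"
      if "\<sigma> \<in> hubs L" "xs \<in> hub_lists L K" for \<sigma> xs
    proof (rule ccontr)
      assume "\<not> ?thesis"
      moreover have "schedule xs k \<in> hubs L" for k
        using that(2) \<open>0 < L\<close> schedule_in_hubs by (auto simp: hub_lists_def)
      ultimately have "of_nat (K * L ^ 3) \<le> price (D \<omega>) (A (\<sigma>, xs))"
        using card_infected_game[OF that(1)] unfolding A_def by (intro price_ge_rounds) auto
      moreover have "ennreal x \<le> of_nat (K * L ^ 3)"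
        using x by (metis ennreal_leI ennreal_of_nat_eq_real_of_nat)
      ultimately have "ennreal x \<le> price (D \<omega>) (A (\<sigma>, xs))" by (rule order_trans[rotated])
      then show False using elim that by (auto simp: P_def)
    qed
    have "(\<Sum>q\<in>P. indicator (?W q) \<omega>) \<le> (\<Sum>q\<in>P. if wins (D \<omega>) (A q) then 1 else 0 :: real)"
      by (intro sum_mono) (auto simp: indicator_def)
    also have "\<dots> = real (card {q\<in>P. wins (D \<omega>) (A q)})"
      using finP by (simp flip: sum.inter_filter)
    also have "{q\<in>P. wins (D \<omega>) (A q)} =
        {(\<sigma>, xs) \<in> hubs L \<times> hub_lists L K. wins (D \<omega>) (game_adversary L \<sigma> (schedule xs))}"
      by (auto simp: P_def A_def)
    finally show ?case
      using card_wins_game[OF \<open>0 < L\<close> stop] by linarith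
  qed
  have int: "integrable M (\<lambda>\<omega>. indicator (?W q) \<omega> :: real)" if "q \<in> P" for q
    using sets[OF that] by (simp add: emeasure_eq_measure)
  have "p * real (L ^ 3 * (L ^ 3) ^ K) = (\<Sum>q\<in>P. p)"
    by (simp add: cardP mult.commute del: of_nat_mult of_nat_power)
  also have "\<dots> \<le> (\<Sum>q\<in>P. prob (?W q))"
    by (intro sum_mono win)
  also have "\<dots> = (\<Sum>q\<in>P. (\<integral>\<omega>. indicator (?W q) \<omega> \<partial>M))"
    using sets by (intro sum.cong) (simp_all add: Int_absorb1 sets.sets_into_space)
  also have "\<dots> = (\<integral>\<omega>. (\<Sum>q\<in>P. indicator (?W q) \<omega>) \<partial>M)"
    using int by (simp add: Bochner_Integration.integral_sum)
  also have "\<dots> \<le> real (L ^ 3 * (L ^ 3) ^ K) - real ((L ^ 3 - 1) ^ K * (L ^ 3 - (K + 1)))"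
    using int few by (intro integral_le_const Bochner_Integration.integrable_sum) auto
  finally show False using small by simp
qed

lemma winning_count_bound:
  fixes N K :: nat and p q :: real
  assumes "0 < N" "real (K + 1) \<le> q * N" "q < 1" "1 - p < (1 - q)\<^sup>2"
  shows "real (N * N ^ K) - real ((N - 1) ^ K * (N - (K + 1))) < p * real (N * N ^ K)"
proof -
  have "q * real N < 1 * real N" using assms(1,3) by (intro mult_strict_right_mono) auto
  then have K: "K + 1 < N" using assms(2) by simp
  have eq: "real ((N - 1) ^ K * (N - (K + 1)))
      = (1 + - 1 / N) ^ K * (1 - (K + 1) / N) * real (N * N ^ K)"
  proof -
    have "real (N - 1) = (1 + - 1 / N) * N" "real (N - (K + 1)) = (1 - (K + 1) / N) * N"
      using K by (simp_all add: of_nat_diff field_simps)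
    then show ?thesis by (simp add: power_mult_distrib)
  qed
  have q: "(K + 1) / N \<le> q" using assms(1,2) by (simp add: field_simps)
  have "1 - q \<le> 1 + real K * (- 1 / N)" using assms(1) q by (simp add: field_simps)
  also have "\<dots> \<le> (1 + - 1 / N) ^ K"
    using assms(1) by (intro Bernoulli_inequality) simp
  finally have "(1 - q)\<^sup>2 \<le> (1 + - 1 / N) ^ K * (1 - (K + 1) / N)"
    unfolding power2_eq_square using q \<open>q < 1\<close> by (intro mult_mono) auto
  then have "1 - p < (1 + - 1 / N) ^ K * (1 - (K + 1) / N)" using assms(4) by simp
  then have "(1 - p) * real (N * N ^ K) < real ((N - 1) ^ K * (N - (K + 1)))"
    unfolding eq using assms(1) by (intro mult_strict_right_mono) auto
  then show ?thesis by (simp add: algebra_simps)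
qed

theorem theorem7:
  fixes M :: "'w measure" and D :: "'w \<Rightarrow> strategy" and p :: real
  assumes "discoverer M D"
    and "0 < p"
    and "solves_source_detection M D p"
  shows "\<exists>G :: nat \<Rightarrow> temporal_graph.
           strict_mono (\<lambda>i. card (verts (G i))) \<and>
           (\<forall>i. \<exists>A. wf_adversary A \<and> graph A = G i \<and>
              0 < measure M {\<omega> \<in> space M.
                    ennreal (min (1/3) (p/2) * (real (card (verts (G i))))\<^sup>2) \<le> price (D \<omega>) A})"
proof -
  define c where "c = min (1/3) (p/2)"
  have c: "0 < c" "c < 1" "2 * c \<le> p" using \<open>0 < p\<close> by (auto simp: c_def)
  define q where "q L = c * (1 + 3 * inverse (real L))\<^sup>2 + 2 * inverse (real L) ^ 3" for L
  have "q \<longlonglongrightarrow> c * (1 + 3 * 0)\<^sup>2 + 2 * 0 ^ 3"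
    unfolding q_def by (intro tendsto_intros lim_inverse_n)
  then have q: "q \<longlonglongrightarrow> c" by simp
  have "(\<lambda>L. (1 - q L)\<^sup>2) \<longlonglongrightarrow> (1 - c)\<^sup>2"
    by (intro tendsto_intros q)
  moreover have "1 - p < (1 - c)\<^sup>2"
  proof -
    have "(1 - c)\<^sup>2 = 1 - 2 * c + c\<^sup>2" by (simp add: power2_diff)
    moreover have "0 < c\<^sup>2" using c(1) by simp
    ultimately show ?thesis using c(3) by linarith
  qed
  ultimately have "\<forall>\<^sub>F L in sequentially. 1 - p < (1 - q L)\<^sup>2"
    by (rule order_tendstoD(1))
  moreover have "\<forall>\<^sub>F L in sequentially. q L < 1"
    using q c(2) by (rule order_tendstoD(2))
  ultimately have "\<forall>\<^sub>F L in sequentially. q L < 1 \<and> 1 - p < (1 - q L)\<^sup>2"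
    by eventually_elim simp
  then obtain L\<^sub>0 where L\<^sub>0: "\<And>L. L \<ge> L\<^sub>0 \<Longrightarrow> q L < 1 \<and> 1 - p < (1 - q L)\<^sup>2"
    by (auto simp: eventually_sequentially)
  have "\<exists>A. wf_adversary A \<and> verts (graph A) = nodes L \<and>
      0 < measure M {\<omega> \<in> space M. ennreal (c * (real (card (nodes L)))\<^sup>2) \<le> price (D \<omega>) A}"
    if L: "L \<ge> L\<^sub>0" "0 < L" for L
  proof -
    define K where "K = nat \<lceil>c * (real (card (nodes L)))\<^sup>2 / L ^ 3\<rceil>"
    have n: "real (card (nodes L)) = real L ^ 3 * (1 + 3 * inverse (real L))"
      using L(2) by (simp add: card_nodes field_simps power2_eq_square power3_eq_cube)
    have K: "c * (real (card (nodes L)))\<^sup>2 / L ^ 3 \<le> K"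
        "K \<le> c * (real (card (nodes L)))\<^sup>2 / L ^ 3 + 1"
      unfolding K_def using c(1) by (simp_all add: of_nat_nat)
    have "c * (real (card (nodes L)))\<^sup>2 / L ^ 3 + 2 = q L * L ^ 3"
    proof -
      have "inverse (real L) * real L = 1" using L(2) by simp
      then have "inverse (real L) ^ 3 * real L ^ 3 = 1" by (simp flip: power_mult_distrib)
      moreover have "c * (N * y)\<^sup>2 / N + 2 = (c * y\<^sup>2 + 2 * z) * N" if "z * N = 1" for N y z :: real
      proof -
        have "(c * y\<^sup>2 + 2 * z) * N = c * y\<^sup>2 * N + 2 * (z * N)" by (simp add: algebra_simps)
        then show ?thesis using that by (cases "N = 0") (simp_all add: power2_eq_square)
      qed
      ultimately show ?thesis unfolding n q_def of_nat_power by blast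
    qed
    then have "real (K + 1) \<le> q L * (L ^ 3)" using K(2) by simp
    then have small: "real (L ^ 3 * (L ^ 3) ^ K) - real ((L ^ 3 - 1) ^ K * (L ^ 3 - (K + 1)))
        < p * real (L ^ 3 * (L ^ 3) ^ K)"
      using L L\<^sub>0[OF L(1)] by (intro winning_count_bound[where q = "q L"]) simp_all
    have "c * (real (card (nodes L)))\<^sup>2 \<le> real (K * L ^ 3)"
      using K(1) L(2) by (simp add: field_simps)
    note price_game[OF assms(1,3,2) L(2) this small]
    then obtain \<sigma> r where "\<sigma> \<in> hubs L" "\<And>k. r k \<in> hubs L"
        "0 < measure M {\<omega> \<in> space M.
          ennreal (c * (real (card (nodes L)))\<^sup>2) \<le> price (D \<omega>) (game_adversary L \<sigma> r)}"
      by blast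
    then show ?thesis
      by (intro exI[of _ "game_adversary L \<sigma> r"]) (simp add: wf_game_adversary)
  qed
  from this[of "L\<^sub>0 + Suc i" for i]
  have "\<forall>i. \<exists>A. wf_adversary A \<and> verts (graph A) = nodes (L\<^sub>0 + Suc i) \<and>
      0 < measure M {\<omega> \<in> space M.
        ennreal (c * (real (card (nodes (L\<^sub>0 + Suc i))))\<^sup>2) \<le> price (D \<omega>) A}"
    by simp
  from choice[OF this] obtain A where "\<forall>i. wf_adversary (A i) \<and>
      verts (graph (A i)) = nodes (L\<^sub>0 + Suc i) \<and>
      0 < measure M {\<omega> \<in> space M.
        ennreal (c * (real (card (nodes (L\<^sub>0 + Suc i))))\<^sup>2) \<le> price (D \<omega>) (A i)}" ..
  then have A: "wf_adversary (A i)" "verts (graph (A i)) = nodes (L\<^sub>0 + Suc i)"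
      "0 < measure M {\<omega> \<in> space M.
        ennreal (c * (real (card (nodes (L\<^sub>0 + Suc i))))\<^sup>2) \<le> price (D \<omega>) (A i)}" for i
    by simp_all
  have "strict_mono (\<lambda>i. card (verts (graph (A i))))"
    unfolding A(2) card_nodes
  proof (rule strict_monoI)
    fix i j :: nat
    assume "i < j"
    then have "L\<^sub>0 + Suc i < L\<^sub>0 + Suc j" by simp
    from power_strict_mono[OF this, of 3] power_strict_mono[OF this, of 2]
    show "(L\<^sub>0 + Suc i) ^ 3 + 3 * (L\<^sub>0 + Suc i)\<^sup>2 < (L\<^sub>0 + Suc j) ^ 3 + 3 * (L\<^sub>0 + Suc j)\<^sup>2"
      by linarith
  qed
  moreover have "\<exists>B. wf_adversary B \<and> graph B = graph (A i) \<and>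
      0 < measure M {\<omega> \<in> space M.
        ennreal (min (1/3) (p/2) * (real (card (verts (graph (A i)))))\<^sup>2) \<le> price (D \<omega>) B}" for i
    using A(1)[of i] A(3)[of i] unfolding A(2) c_def by blast
  ultimately show ?thesis by (intro exI[of _ "\<lambda>i. graph (A i)"] conjI allI)
qed

end
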